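(* Let $m\ge 1$, and let $u$ be a (real-valued, nonzero) eigenfunction of the graph Laplacian $-\Delta_m$ on the level-$m$ cell graph $\Gamma_m$ of the projective octagasket, with corresponding eigenvalue of multiplicity $1$. Then one of the following is true about $u$: (O) $u$ is invariant under $D_8$ (the full symmetry group, of order $16$, of the regular octagon); (E) $u$ is symmetric about a line through the mid-points of opposite edges of the octagon; (R) $u$ is invariant under the rotation by $\frac{\pi}{4}$; (C) $u$ is symmetric about a line through two opposite corners of the octagon.
   Context: Let $\rho=\frac{1}{2+\sqrt2}$ and for $n=0,\dots,7$ let $F_n(x,y)=\rho\,\bigl(x+(1+\sqrt2)\cos\frac{(5-2n)\pi}{8},\; y+(1+\sqrt2)\sin\frac{(5-2n)\pi}{8}\bigr)$. Let $P\subset\mathbb{R}^2$ be the closed filled regular octagon centered at the origin with vertices $V_0=\{(\cos\frac{(5-2n)\pi}{8},\sin\frac{(5-2n)\pi}{8}) : n=0,\dots,7\}$. For a word $w=(j_1,\dots,j_m)\in\{0,\dots,7\}^m$ put $F_w=F_{j_1}\circ\cdots\circ F_{j_m}$ and $P_w=F_w(P)$. The octagons $P_w$ have disjoint interiors and two of them can share a full edge. Level-$m$ cell graph $\Gamma_m$ ($m\ge1$): let $O_m=\bigcup_{|w|=m}P_w$. The complement $\mathbb{R}^2\setminus O_m$ has one unbounded component and finitely many bounded components (the central holes of cells, and the holes, called pseudo-cells, between neighbouring cells). Each component $H$ is centrally symmetric about a point $c_H$ (with $c_H=0$ for the unbounded one). Identify each point $x\in\partial H$ with its antipode $2c_H-x$,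 for every component $H$. After these identifications each of the 8 edges of each octagon $P_w$ is shared with exactly one other octagon. The $m$-cells are the $8^m$ octagons $P_w$; $\Gamma_m$ is the multigraph whose vertices are the $m$-cells, with as many graph edges between two distinct $m$-cells as the number of octagon edges they share, so every $m$-cell has degree 8 counting multiplicity. The graph Laplacian acts on functions $u$ on the set of $m$-cells by $-\Delta_m u(A)=\sum_{B}(u(A)-u(B))$, the sum being over the 8 neighbours $B$ of $A$ counted with multiplicity. The symmetry group $D_8$ of $P$ acts on the plane preserving $O_m$ and the identifications, hence permutes the $m$-cells; "invariant"/"symmetric" for a function on $m$-cells refers to this action ($u\circ g=u$). The lines in (E) and (C), and the rotation in (R), refer to the octagon $P$ centered at the origin. The multiplicity of an eigenvalue is the dimension of its eigenspace. *)

theory Defs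
  imports "HOL-Analysis.Analysis" "HOL-Library.Function_Algebras"
begin

text \<open>The Euclidean plane is the type \<^typ>\<open>complex\<close>; the point $(x,y)$ is $x + iy$.\<close>

text \<open>\<open>octV n\<close> has period 8 in \<open>n\<close>, and consecutive indices are consecutive corners.\<close>

definition octV :: "nat \<Rightarrow> complex" where
  "octV n = Complex (cos ((5 - 2 * real n) * pi / 8)) (sin ((5 - 2 * real n) * pi / 8))"

definition octP :: "complex set" where
  "octP = convex hull (octV ` {0..7})"

definition octF :: "nat \<Rightarrow> complex \<Rightarrow> complex" where
  "octF n z = (1 / (2 + sqrt 2)) *\<^sub>R (z + (1 + sqrt 2) *\<^sub>R octV n)"

definition octFw :: "nat list \<Rightarrow> complex \<Rightarrow> complex" where
  "octFw w = foldr (\<lambda>j f. octF j \<circ> f) w id"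

definition cells :: "nat \<Rightarrow> complex set set" where
  "cells m = {octFw w ` octP | w. length w = m \<and> set w \<subseteq> {0..7}}"

definition cellUnion :: "nat \<Rightarrow> complex set" where
  "cellUnion m = \<Union> (cells m)"

text \<open>A component of the complement of \<open>cellUnion m\<close> has at most one centre of symmetry:
  two distinct ones would make it invariant under a nontrivial translation, whereas the component
  or its complement is bounded and nonempty. For the unbounded component the centre is 0.\<close>

definition is_centre :: "complex \<Rightarrow> complex set \<Rightarrow> bool" where
  "is_centre c H \<longleftrightarrow> (\<lambda>x. 2 * c - x) ` H = H"

definition antipodal :: "nat \<Rightarrow> complex \<Rightarrow> complex \<Rightarrow> bool" where
  "antipodal m x y \<longleftrightarrow>
     (\<exists>H \<in> components (- cellUnion m). \<exists>c. is_centre c H \<and> x \<in> frontier H \<and> y = 2 * c - x)"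

text \<open>The image of a set in the quotient of the plane by the identifications, a point of the
  quotient being an equivalence class.\<close>

definition quot_image :: "nat \<Rightarrow> complex set \<Rightarrow> complex set set" where
  "quot_image m e = (\<lambda>x. {y. equivclp (antipodal m) x y}) ` e"

definition quot_edges :: "nat \<Rightarrow> complex set \<Rightarrow> complex set set set" where
  "quot_edges m A = quot_image m ` {e. e edge_of A}"

text \<open>The number of graph edges joining two distinct cells. Edges of octagons that coincide
  already in the plane also coincide in the quotient, so they are counted too.\<close>

definition edge_mult :: "nat \<Rightarrow> complex set \<Rightarrow> complex set \<Rightarrow> nat" where
  "edge_mult m A B = card (quot_edges m A \<inter> quot_edges m B)"

text \<open>This is $-\Delta_m$, the positive semidefinite sign convention.\<close>

definition neg_laplacian :: "nat \<Rightarrow> (complex set \<Rightarrow> real) \<Rightarrow> complex set \<Rightarrow> real" where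
  "neg_laplacian m u A = (\<Sum>B \<in> cells m - {A}. real (edge_mult m A B) * (u A - u B))"

text \<open>Functions on the \<open>m\<close>-cells are represented by functions on all sets that vanish
  off \<open>cells m\<close>.\<close>

definition eigenspace :: "nat \<Rightarrow> real \<Rightarrow> (complex set \<Rightarrow> real) set" where
  "eigenspace m l = {u. (\<forall>A. A \<notin> cells m \<longrightarrow> u A = 0) \<and>
                        (\<forall>A \<in> cells m. neg_laplacian m u A = l * u A)}"

definition eigenfunction :: "nat \<Rightarrow> real \<Rightarrow> (complex set \<Rightarrow> real) \<Rightarrow> bool" where
  "eigenfunction m l u \<longleftrightarrow> u \<in> eigenspace m l \<and> u \<noteq> (\<lambda>_. 0)"

definition fun_scale :: "real \<Rightarrow> (complex set \<Rightarrow> real) \<Rightarrow> complex set \<Rightarrow> real" where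
  "fun_scale c f = (\<lambda>A. c * f A)"

lemma vector_space_fun_scale: "vector_space fun_scale"
  by unfold_locales (auto simp: fun_scale_def fun_eq_iff algebra_simps)

definition multiplicity_of :: "nat \<Rightarrow> real \<Rightarrow> nat" where
  "multiplicity_of m l = vector_space.dim fun_scale (eigenspace m l)"

definition D8 :: "(complex \<Rightarrow> complex) set" where
  "D8 = {g. (\<forall>x y. dist (g x) (g y) = dist x y) \<and> g ` octP = octP}"

definition invariant_under :: "nat \<Rightarrow> (complex \<Rightarrow> complex) \<Rightarrow> (complex set \<Rightarrow> real) \<Rightarrow> bool" where
  "invariant_under m g u \<longleftrightarrow> (\<forall>A \<in> cells m. u (g ` A) = u A)"

text \<open>Reflection in a line \<open>L\<close>: the closest point of \<open>L\<close> is the foot of the perpendicular.\<close>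

definition reflection :: "complex set \<Rightarrow> complex \<Rightarrow> complex" where
  "reflection L x = 2 * closest_point L x - x"

definition line_through :: "complex \<Rightarrow> complex \<Rightarrow> complex set" where
  "line_through a b = affine hull {a, b}"

definition edge_midpoint :: "nat \<Rightarrow> complex" where
  "edge_midpoint n = midpoint (octV n) (octV (n + 1))"

definition rotation :: "real \<Rightarrow> complex \<Rightarrow> complex" where
  "rotation t z = cis t * z"

end

theory Submission
  imports Defs
begin

text \<open>A simple eigenspace is a line, so each involutive symmetry of the cell graph multiplies its
  eigenfunctions by $\pm 1$. If one of two reflections, in a line through mid-points of edges and in
  a neighbouring line through corners, acts by $+1$, we are in case (E) or (C). Otherwise both act
  by $-1$, and their composition, the rotation by $\pi/4$, acts by $+1$: case (R).\<close>

section \<open>Invertible linear maps\<close>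

lemma homeomorphism_bij_linear:
  fixes g :: "'a::euclidean_space \<Rightarrow> 'a"
  assumes "linear g" "bij g"
  shows "homeomorphism S (g ` S) g (inv g)"
proof -
  \<comment> \<open>In finite dimension an injective linear map has a linear left inverse, which is
    \<open>inv g\<close> here; linearity then makes it continuous.\<close>
  have "linear (inv g)"
    using assms by (metis bij_is_inj inj_iff linear_injective_left_inverse linear_inverse_left
        left_right_inverse_eq bij_is_surj surj_iff)
  then show ?thesis
    using assms by (simp add: homeomorphism_def bij_is_inj bij_is_surj image_image surj_f_inv_f
        linear_continuous_on linear_conv_bounded_linear)
qed

lemma components_homeomorphism:
  assumes "homeomorphism S T f f'"
  shows "components T = (`) f ` components S"
proof -
  have "T = f ` S"
    using assms by (simp add: homeomorphism_def)
  then show ?thesis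
    using connected_component_set_homeomorphism[OF assms]
    by (auto simp: components_def image_image)
qed

lemma frontier_bij_linear_image:
  fixes g :: "'a::euclidean_space \<Rightarrow> 'a"
  assumes "linear g" "bij g"
  shows "frontier (g ` S) = g ` frontier S"
  unfolding frontier_def
  using bij_is_inj[OF assms(2)] assms(1)
  by (metis closure_injective_linear_image interior_injective_linear_image image_set_diff)

lemma edges_of_bij_linear_image:
  fixes g :: "'a::euclidean_space \<Rightarrow> 'a"
  assumes "linear g" "bij g"
  shows "{e. e edge_of g ` A} = (`) g ` {e. e edge_of A}"
proof -
  have "e edge_of A \<longleftrightarrow> g ` e edge_of g ` A" for e
    using assms by (simp add: edge_of_def bij_is_inj face_of_linear_image)
  \<comment> \<open>Surjectivity makes every set an image, so each edge of the image of
    \<open>A\<close> can be pulled back.\<close>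
  moreover have "\<exists>e'. e = g ` e'" for e
    using assms(2) by (metis bij_is_surj surj_image_vimage_eq)
  ultimately show ?thesis
    by (auto simp: image_iff) metis
qed

section \<open>Symmetries of the octagon acting on the cell graph\<close>

text \<open>Convex hulls, edges, components, frontiers and centres of symmetry are all preserved by
  linear bijections, so no metric condition appears. Inclusion is enough for the corners: an
  injective self-map of a finite set is onto.\<close>

definition octV_symmetry :: "(complex \<Rightarrow> complex) \<Rightarrow> bool" where
  "octV_symmetry g \<longleftrightarrow> linear g \<and> bij g \<and> g ` octV ` {0..7} \<subseteq> octV ` {0..7}"

context
  fixes g :: "complex \<Rightarrow> complex"
  assumes g: "octV_symmetry g"
begin

lemma octV_symmetry_linear: "linear g" and octV_symmetry_bij: "bij g"
  using g by (auto simp: octV_symmetry_def)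

lemma octV_symmetry_inj_image: "inj ((`) g)"
  using octV_symmetry_bij by (simp add: bij_is_inj inj_on_image)

lemma octV_symmetry_octP: "g ` octP = octP"
proof -
  have "g ` octV ` {0..7} = octV ` {0..7}"
    using g inj_on_subset[OF bij_is_inj[OF octV_symmetry_bij]]
    by (intro endo_inj_surj) (simp_all add: octV_symmetry_def)
  then show ?thesis
    by (simp add: octP_def octV_symmetry_linear convex_hull_linear_image flip: image_comp)
qed

text \<open>\<open>octF j\<close> is the homothety of ratio 1/(2 + sqrt 2) fixing
  \<open>octV j\<close>, so moving it past \<open>g\<close> only relabels the corner. Doing this
  letter by letter relabels the whole word.\<close>

lemma octV_symmetry_octFw:
  assumes "set w \<subseteq> {0..7}"
  shows "\<exists>w'. length w' = length w \<and> set w' \<subseteq> {0..7} \<and> (\<forall>z. g (octFw w z) = octFw w' (g z))"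
  using assms
proof (induction w)
  case Nil
  show ?case
    by (rule exI[of _ "[]"]) (simp add: octFw_def)
next
  case (Cons j w)
  then obtain w' where w': "length w' = length w" "set w' \<subseteq> {0..7}"
      "\<And>z. g (octFw w z) = octFw w' (g z)"
    by auto
  have "g (octV j) \<in> octV ` {0..7}"
    using g Cons.prems by (auto simp: octV_symmetry_def)
  then obtain j' where j': "j' \<in> {0..7}" "g (octV j) = octV j'"
    by auto
  have "g (octF j z) = octF j' (g z)" for z
    using j'(2) by (simp add: octF_def linear_cmul linear_add octV_symmetry_linear)
  then have "g (octFw (j # w) z) = octFw (j' # w') (g z)" for z
    using w'(3) by (simp add: octFw_def)
  then show ?case
    using w' j' by (intro exI[of _ "j' # w'"]) auto
qed

lemma octV_symmetry_cells: "(`) g ` cells m = cells m"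
proof (rule endo_inj_surj)
  have "cells m = (\<lambda>w. octFw w ` octP) ` {w. set w \<subseteq> {0..7} \<and> length w = m}"
    by (auto simp: cells_def)
  then show "finite (cells m)"
    by (simp add: finite_lists_length_eq)
  show "inj_on ((`) g) (cells m)"
    using octV_symmetry_inj_image by (rule inj_on_subset) simp
  show "(`) g ` cells m \<subseteq> cells m"
  proof clarify
    fix A assume "A \<in> cells m"
    then obtain w where w: "length w = m" "set w \<subseteq> {0..7}" "A = octFw w ` octP"
      by (auto simp: cells_def)
    then obtain w' where w': "length w' = m" "set w' \<subseteq> {0..7}"
        "\<And>z. g (octFw w z) = octFw w' (g z)"
      using octV_symmetry_octFw by blast
    have "g ` A = octFw w' ` g ` octP"
      using w w' by (simp add: image_image)
    then show "g ` A \<in> cells m"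
      using w' by (auto simp: cells_def octV_symmetry_octP)
  qed
qed

lemma octV_symmetry_in_cells: "g ` A \<in> cells m \<longleftrightarrow> A \<in> cells m"
  using octV_symmetry_cells octV_symmetry_inj_image by (metis inj_image_mem_iff)

section \<open>Holes and the antipodal identification\<close>

lemma octV_symmetry_components:
  "components (- cellUnion m) = (`) g ` components (- cellUnion m)"
proof -
  have "g ` cellUnion m = cellUnion m"
    using octV_symmetry_cells[of m] by (metis cellUnion_def image_Union)
  then have "g ` (- cellUnion m) = - cellUnion m"
    by (simp add: bij_image_Compl_eq octV_symmetry_bij)
  then show ?thesis
    using components_homeomorphism[OF homeomorphism_bij_linear] octV_symmetry_linear
      octV_symmetry_bij by metis
qed

lemma octV_symmetry_point_reflection: "g (2 * c - x) = 2 * g c - g x"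
  unfolding mult_2 linear_diff[OF octV_symmetry_linear] linear_add[OF octV_symmetry_linear] ..

lemma octV_symmetry_is_centre: "is_centre (g c) (g ` H) \<longleftrightarrow> is_centre c H"
proof -
  have "(\<lambda>x. 2 * g c - x) ` g ` H = g ` (\<lambda>x. 2 * c - x) ` H"
    by (simp add: image_image octV_symmetry_point_reflection)
  then show ?thesis
    unfolding is_centre_def using octV_symmetry_inj_image by (metis injD)
qed

lemma octV_symmetry_antipodal: "antipodal m (g x) (g y) \<longleftrightarrow> antipodal m x y"
proof -
  \<comment> \<open>Both quantifiers in \<open>antipodal\<close> are reindexed along
    \<open>g\<close>: components because \<open>g\<close> permutes them, centres because
    \<open>g\<close> is onto.\<close>
  have C: "(\<exists>H \<in> components (- cellUnion m). Q H) \<longleftrightarrow> (\<exists>H \<in> components (- cellUnion m). Q (g ` H))"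
    for Q
    by (subst octV_symmetry_components) simp
  have c: "(\<exists>c. Q c) \<longleftrightarrow> (\<exists>c. Q (g c))" for Q
    using bij_is_surj[OF octV_symmetry_bij] by (metis surjD)
  have "is_centre (g c) (g ` H) \<and> g x \<in> frontier (g ` H) \<and> g y = 2 * g c - g x \<longleftrightarrow>
      is_centre c H \<and> x \<in> frontier H \<and> y = 2 * c - x" for c H
    unfolding octV_symmetry_is_centre octV_symmetry_point_reflection[symmetric]
      frontier_bij_linear_image[OF octV_symmetry_linear octV_symmetry_bij]
    using bij_is_inj[OF octV_symmetry_bij] by (metis inj_image_mem_iff injD)
  then show ?thesis
    unfolding antipodal_def by (subst C, subst c) blast
qed

lemma octV_symmetry_equivclp:
  "equivclp (antipodal m) (g x) (g y) \<longleftrightarrow> equivclp (antipodal m) x y"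
proof
  assume "equivclp (antipodal m) x y"
  then show "equivclp (antipodal m) (g x) (g y)"
    by (induction rule: equivclp_induct)
      (auto intro: equivclp_into_equivclp simp: octV_symmetry_antipodal)
next
  \<comment> \<open>The endpoints are generalised for the induction: a chain starting at
    \<open>g x\<close> is pulled back point by point, each point being an image under
    \<open>g\<close>.\<close>
  have "equivclp (antipodal m) x' y' \<Longrightarrow> x' = g x \<Longrightarrow> \<exists>y. y' = g y \<and> equivclp (antipodal m) x y"
    for x' y'
  proof (induction rule: equivclp_induct)
    case (step y' z')
    then show ?case
      by (metis bij_pointE equivclp_into_equivclp octV_symmetry_antipodal octV_symmetry_bij)
  qed auto
  then show "equivclp (antipodal m) (g x) (g y) \<Longrightarrow> equivclp (antipodal m) x y"
    using octV_symmetry_bij by (metis bij_is_inj inj_eq)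
qed

lemma octV_symmetry_quot_image: "quot_image m (g ` e) = (`) g ` quot_image m e"
proof -
  have "{y. equivclp (antipodal m) (g x) y} = g ` {y. equivclp (antipodal m) x y}" for x
    using octV_symmetry_equivclp octV_symmetry_bij
    by (auto simp: image_iff) (metis bij_pointE)
  then show ?thesis
    by (simp add: quot_image_def image_image)
qed

section \<open>Edge multiplicities and the Laplacian\<close>

lemma octV_symmetry_edge_mult: "edge_mult m (g ` A) (g ` B) = edge_mult m A B"
proof -
  \<comment> \<open>Members of \<open>quot_edges m A\<close> are sets of equivalence classes, so
    \<open>g\<close> acts on them through two levels of image. Injectivity there preserves
    intersections and cardinalities.\<close>
  have inj: "inj ((`) ((`) g))"
    using octV_symmetry_inj_image by (simp add: inj_on_image)
  have "quot_edges m (g ` A) = (`) ((`) g) ` quot_edges m A" for A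
    by (simp add: quot_edges_def edges_of_bij_linear_image octV_symmetry_linear octV_symmetry_bij
        image_image octV_symmetry_quot_image)
  then have "quot_edges m (g ` A) \<inter> quot_edges m (g ` B)
      = (`) ((`) g) ` (quot_edges m A \<inter> quot_edges m B)"
    by (simp add: image_Int inj)
  then show ?thesis
    unfolding edge_mult_def using inj by (metis card_image inj_on_subset subset_UNIV)
qed

lemma octV_symmetry_neg_laplacian:
  "neg_laplacian m (\<lambda>A. u (g ` A)) A = neg_laplacian m u (g ` A)"
proof -
  have "(`) g ` (cells m - {A}) = cells m - {g ` A}"
    using octV_symmetry_cells octV_symmetry_inj_image by (simp add: image_set_diff)
  then have "bij_betw ((`) g) (cells m - {A}) (cells m - {g ` A})"
    using octV_symmetry_inj_image by (metis inj_on_imp_bij_betw inj_on_subset subset_UNIV)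
  from sum.reindex_bij_betw[OF this, of "\<lambda>B. real (edge_mult m (g ` A) B) * (u (g ` A) - u B)"]
  show ?thesis
    by (simp add: neg_laplacian_def octV_symmetry_edge_mult)
qed

lemma octV_symmetry_eigenspace:
  assumes "u \<in> eigenspace m l"
  shows "(\<lambda>A. u (g ` A)) \<in> eigenspace m l"
proof -
  have "u (g ` A) = 0" if "A \<notin> cells m" for A
    using assms that octV_symmetry_in_cells[of A m] by (simp add: eigenspace_def)
  moreover have "neg_laplacian m (\<lambda>A. u (g ` A)) A = l * u (g ` A)" if "A \<in> cells m" for A
    using assms that octV_symmetry_in_cells[of A m]
    unfolding octV_symmetry_neg_laplacian by (simp add: eigenspace_def)
  ultimately show ?thesis
    by (simp add: eigenspace_def)
qed

end

section \<open>Eigenvalues of multiplicity one\<close>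

text \<open>A basis of the eigenspace is a single vector \<open>b\<close>. Since \<open>u\<close> is
  nonzero, its coefficient \<open>p\<close> can be divided by, and \<open>u\<close> spans the
  eigenspace too.\<close>

lemma simple_eigenvalue_proportional:
  assumes "eigenfunction m l u" "multiplicity_of m l = 1" "v \<in> eigenspace m l"
  obtains c where "v = fun_scale c u"
proof -
  interpret fs: vector_space fun_scale
    by (rule vector_space_fun_scale)
  obtain B where B: "eigenspace m l \<subseteq> fs.span B" "card B = 1"
    using fs.basis_exists assms(2) unfolding multiplicity_of_def by metis
  then obtain b where "B = {b}"
    by (meson card_1_singletonE)
  then have "u \<in> range (\<lambda>k. fun_scale k b)" "v \<in> range (\<lambda>k. fun_scale k b)"
    using B(1) assms(1,3) by (auto simp: eigenfunction_def fs.span_singleton)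
  then obtain p q where p: "u = fun_scale p b" and q: "v = fun_scale q b"
    by blast
  have "p \<noteq> 0"
    using assms(1) p by (auto simp: eigenfunction_def fun_scale_def)
  then have "v = fun_scale (q / p) u"
    by (simp add: p q fun_scale_def fun_eq_iff)
  then show ?thesis ..
qed

text \<open>Composition with \<open>g\<close> multiplies \<open>u\<close> by some \<open>c\<close>.
  Applying the involution twice where \<open>u\<close> is nonzero gives
  \<open>c * c = 1\<close>.\<close>

lemma simple_eigenfunction_sign:
  assumes "octV_symmetry g" "\<And>x. g (g x) = x" "eigenfunction m l u" "multiplicity_of m l = 1"
  shows "(\<forall>A. u (g ` A) = u A) \<or> (\<forall>A. u (g ` A) = - u A)"
proof -
  obtain c where "(\<lambda>A. u (g ` A)) = fun_scale c u"
    using simple_eigenvalue_proportional octV_symmetry_eigenspace assms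
    by (metis eigenfunction_def)
  then have c: "u (g ` A) = c * u A" for A
    by (simp add: fun_scale_def fun_eq_iff)
  obtain A where A: "u A \<noteq> 0"
    using assms(3) by (auto simp: eigenfunction_def fun_eq_iff)
  have "u (g ` g ` A) = c * (c * u A)"
    by (simp only: c)
  then have "c * c = 1"
    using A by (simp add: image_image assms(2))
  then have "c = 1 \<or> c = -1"
    by (simp add: square_eq_1_iff)
  then show ?thesis
    by (auto simp: c)
qed

section \<open>The two reflections\<close>

text \<open>In the coordinate \<open>w = x / a\<close> the line is the real axis, the closest point
  is \<open>Re w\<close> and the reflection is conjugation.\<close>

lemma reflection_line_through_antipodes:
  assumes "a \<noteq> 0"
  shows "reflection (line_through a (- a)) x = a / cnj a * cnj x"
proof -
  define L where "L = line_through a (- a)"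
  have L: "z \<in> L \<longleftrightarrow> (\<exists>t::real. z = a * t)" for z
  proof
    assume "z \<in> L"
    then obtain s t :: real where "z = s *\<^sub>R a + t *\<^sub>R (- a)"
      by (auto simp: L_def line_through_def affine_hull_2)
    then have "z = a * of_real (s - t)"
      by (simp add: scaleR_conv_of_real algebra_simps)
    then show "\<exists>t::real. z = a * t" ..
  next
    assume "\<exists>t::real. z = a * t"
    then obtain t :: real where "z = a * t" ..
    \<comment> \<open>The weights are determined by having sum 1 and difference
      \<open>t\<close>.\<close>
    then have "z = ((1 + t) / 2) *\<^sub>R a + ((1 - t) / 2) *\<^sub>R (- a)"
      by (simp add: scaleR_conv_of_real field_simps)
    then show "z \<in> L"
      unfolding L_def line_through_def affine_hull_2 mem_Collect_eq
      by (intro exI[of _ "(1 + t) / 2"] exI[of _ "(1 - t) / 2"]) (simp add: field_simps)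
  qed
  define w where "w = x / a"
  have x: "x = a * w"
    using assms by (simp add: w_def)
  have "a * Re w = closest_point L x"
  proof (rule closest_point_unique)
    show "convex L" "closed L"
      by (simp_all add: L_def line_through_def affine_imp_convex)
    show "a * Re w \<in> L"
      unfolding L by blast
    show "\<forall>z\<in>L. dist x (a * Re w) \<le> dist x z"
    proof
      fix z assume "z \<in> L"
      then obtain t :: real where t: "z = a * t"
        using L by blast
      have "w - Re w = \<i> * Im w"
        by (simp add: complex_eq_iff)
      \<comment> \<open>Subtracting the real number \<open>t\<close> leaves the imaginary part of
        \<open>w\<close> unchanged.\<close>
      then have "dist x (a * Re w) = norm a * \<bar>Im (w - t)\<bar>"
        by (simp add: x dist_norm norm_mult flip: right_diff_distrib)
      also have "\<dots> \<le> norm a * norm (w - t)"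
        by (intro mult_left_mono abs_Im_le_cmod) simp
      also have "\<dots> = dist x z"
        by (simp add: x t dist_norm flip: right_diff_distrib norm_mult)
      finally show "dist x (a * Re w) \<le> dist x z" .
    qed
  qed
  then have "reflection L x = a * (2 * Re w - w)"
    by (simp add: reflection_def x algebra_simps)
  also have "2 * Re w - w = cnj w"
    by (simp add: complex_eq_iff)
  finally show ?thesis
    by (simp add: L_def w_def)
qed

section \<open>Corners and edge mid-points in complex form\<close>

lemma octV_eq_cis: "octV n = cis ((5 - 2 * real n) * pi / 8)"
  by (simp add: octV_def complex_eq_iff)

text \<open>Full turns \<open>k\<close> absorb the wrap-around of corner indices modulo 8.\<close>

lemma cis_eq_octV:
  assumes "\<theta> = (5 - 2 * real n) * pi / 8 + 2 * pi * of_int k"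
  shows "cis \<theta> = octV n"
proof -
  have "cis \<theta> = octV n * cis (2 * pi * of_int k)"
    unfolding assms octV_eq_cis by (rule cis_mult[symmetric])
  then show ?thesis
    by simp
qed

lemma octV_add_4: "octV (n + 4) = - octV n"
proof -
  have "(5 - 2 * real (n + 4)) * pi / 8 = (5 - 2 * real n) * pi / 8 - pi"
    by (simp add: field_simps)
  then show ?thesis
    unfolding octV_eq_cis by (simp only: flip: cis_divide) simp
qed

lemma edge_midpoint_add_4: "edge_midpoint (n + 4) = - edge_midpoint n"
  using octV_add_4[of n] octV_add_4[of "Suc n"]
  by (simp add: edge_midpoint_def midpoint_def algebra_simps)

lemma edge_midpoint_0: "edge_midpoint 0 = \<i> * sin (3 * pi / 8)"
proof -
  \<comment> \<open>Corners 0 and 1 have angles 5 pi/8 and 3 pi/8, mirror images in the imaginary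
    axis, so their mid-point lies on it.\<close>
  have "5 * pi / 8 = pi - 3 * pi / 8"
    by simp
  then have "cos (5 * pi / 8) = - cos (3 * pi / 8)" "sin (5 * pi / 8) = sin (3 * pi / 8)"
    by (simp_all only: cos_pi_minus sin_pi_minus)
  then show ?thesis
    by (simp add: edge_midpoint_def midpoint_def octV_def complex_eq_iff)
qed

lemma reflection_edge_midpoints:
  "reflection (line_through (edge_midpoint 0) (edge_midpoint (0 + 4))) x = - cnj x"
proof -
  have "sin (3 * pi / 8) > 0"
    by (rule sin_gt_zero) auto
  then show ?thesis
    unfolding edge_midpoint_add_4
    by (subst reflection_line_through_antipodes) (simp_all add: edge_midpoint_0)
qed

lemma reflection_corners:
  "reflection (line_through (octV 0) (octV (0 + 4))) x = cis (5 * pi / 4) * cnj x"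
proof -
  \<comment> \<open>Dividing a unit number by its conjugate doubles its angle, here 5 pi/8.\<close>
  have "octV 0 / cnj (octV 0) = cis (5 * pi / 4)"
    by (simp add: octV_eq_cis cis_cnj cis_divide)
  moreover have "octV 0 \<noteq> 0"
    by (simp add: octV_eq_cis)
  ultimately show ?thesis
    unfolding octV_add_4 by (simp add: reflection_line_through_antipodes)
qed

section \<open>The reflections as symmetries of the corners\<close>

lemma octV_symmetryI_involution:
  assumes "linear g" "\<And>x. g (g x) = x" "\<And>n. n \<in> {0..7} \<Longrightarrow> g (octV n) \<in> octV ` {0..7}"
  shows "octV_symmetry g"
  using assms by (auto simp: octV_symmetry_def intro: o_bij[of g] simp: fun_eq_iff)

lemma octV_symmetry_edge_reflection: "octV_symmetry (\<lambda>x. - cnj x)"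
proof (rule octV_symmetryI_involution)
  show "linear (\<lambda>x. - cnj x)"
    by (auto intro!: linearI simp: complex_eq_iff)
  fix n :: nat assume n: "n \<in> {0..7}"
  have "- cnj (octV n) = cis (pi - (5 - 2 * real n) * pi / 8)"
    using cis_mult[of pi "- ((5 - 2 * real n) * pi / 8)"] by (simp add: octV_eq_cis cis_cnj)
  \<comment> \<open>The corner index becomes \<open>1 - n\<close> modulo 8; its representative
    \<open>9 - n\<close> costs one full turn.\<close>
  also have "\<dots> = octV (if n \<le> 1 then 1 - n else 9 - n)"
    using n by (intro cis_eq_octV[of _ _ "if n \<le> 1 then 0 else 1"])
      (auto simp: field_simps of_nat_diff)
  finally show "- cnj (octV n) \<in> octV ` {0..7}"
    using n by auto
qed simp

lemma octV_symmetry_corner_reflection: "octV_symmetry (\<lambda>x. cis (5 * pi / 4) * cnj x)"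
proof (rule octV_symmetryI_involution)
  show "linear (\<lambda>x. cis (5 * pi / 4) * cnj x)"
    by (auto intro!: linearI simp: algebra_simps)
  show "cis (5 * pi / 4) * cnj (cis (5 * pi / 4) * cnj x) = x" for x
    by (simp add: cis_cnj cis_mult flip: mult.assoc)
  fix n :: nat assume n: "n \<in> {0..7}"
  have "cis (5 * pi / 4) * cnj (octV n) = cis (5 * pi / 4 - (5 - 2 * real n) * pi / 8)"
    by (simp add: octV_eq_cis cis_cnj cis_mult)
  \<comment> \<open>The corner index is negated modulo 8, fixing corners 0 and 4.\<close>
  also have "\<dots> = octV (if n = 0 then 0 else 8 - n)"
    using n by (intro cis_eq_octV[of _ _ "if n = 0 then 0 else 1"])
      (auto simp: field_simps of_nat_diff)
  finally show "cis (5 * pi / 4) * cnj (octV n) \<in> octV ` {0..7}"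
    using n by auto
qed

text \<open>The mirror lines have angles pi/2 and 5 pi/8, so composing the reflections turns by
  twice their difference.\<close>

lemma corner_reflection_edge_reflection:
  "cis (5 * pi / 4) * cnj (- cnj x) = rotation (pi / 4) x"
proof -
  have "5 * pi / 4 = pi + pi / 4"
    by simp
  then have "cis (5 * pi / 4) = - cis (pi / 4)"
    by (simp only: cis_mult[symmetric] cis_pi) simp
  then show ?thesis
    by (simp add: rotation_def)
qed

theorem proposition5p1:
  fixes m :: nat and l :: real and u :: "complex set \<Rightarrow> real"
  assumes "m \<ge> 1"
    and "eigenfunction m l u"
    and "multiplicity_of m l = 1"
  shows "(\<forall>g \<in> D8. invariant_under m g u)
       \<or> (\<exists>n \<in> {0..7}. invariant_under m
            (reflection (line_through (edge_midpoint n) (edge_midpoint (n + 4)))) u)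
       \<or> invariant_under m (rotation (pi / 4)) u
       \<or> (\<exists>n \<in> {0..7}. invariant_under m
            (reflection (line_through (octV n) (octV (n + 4)))) u)"
proof -
  define r where "r = reflection (line_through (edge_midpoint 0) (edge_midpoint (0 + 4)))"
  define s where "s = reflection (line_through (octV 0) (octV (0 + 4)))"
  have r: "r = (\<lambda>x. - cnj x)" and s: "s = (\<lambda>x. cis (5 * pi / 4) * cnj x)"
    unfolding r_def s_def using reflection_edge_midpoints reflection_corners by blast+
  have r_sign: "(\<forall>A. u (r ` A) = u A) \<or> (\<forall>A. u (r ` A) = - u A)"
    using octV_symmetry_edge_reflection assms(2,3)
    by (intro simple_eigenfunction_sign) (auto simp: r)
  have s_sign: "(\<forall>A. u (s ` A) = u A) \<or> (\<forall>A. u (s ` A) = - u A)"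
    using octV_symmetry_corner_reflection assms(2,3)
    by (intro simple_eigenfunction_sign) (auto simp: s cis_cnj cis_mult simp flip: mult.assoc)
  have "s ` r ` A = rotation (pi / 4) ` A" for A
    unfolding r s image_image corner_reflection_edge_reflection ..
  \<comment> \<open>If both signs are -1, they cancel along the composition \<open>s\<close> after
    \<open>r\<close>.\<close>
  then have "(\<forall>A. u (r ` A) = u A) \<or> (\<forall>A. u (s ` A) = u A) \<or>
      (\<forall>A. u (rotation (pi / 4) ` A) = u A)"
    using r_sign s_sign by (metis minus_minus)
  moreover have "0 \<in> {0..7::nat}"
    by simp
  ultimately show ?thesis
    unfolding invariant_under_def r_def s_def by blast
qed

end
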